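(* Let $q\in\mathbb{R}[w,x,y,z]$ be a real quadratic form in four variables that is not a sum of squares of trinomials. Then for every nonnegative integer $r$ and all real numbers $\lambda_1,\lambda_2,\lambda_3,\lambda_4$, not all zero, the form of degree $2r+2$ $$p=(\lambda_1^2 w^2+\lambda_2^2 x^2+\lambda_3^2 y^2+\lambda_4^2 z^2)^r\, q$$ is not a sum of squares of trinomials.
   Context: A trinomial is a polynomial of the form $\alpha_1 m_1+\alpha_2 m_2+\alpha_3 m_3$ with $\alpha_1,\alpha_2,\alpha_3\in\mathbb{R}$ (possibly zero) and $m_1,m_2,m_3$ monomials in $w,x,y,z$. A sum of squares of trinomials is a finite sum of squares of such polynomials. *)

theory Defs
  imports Complex_Main "HOL-Library.Poly_Mapping"
begin

datatype indet = Ind_w | Ind_x | Ind_y | Ind_z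

text \<open>A monomial is represented by its exponent vector; its coefficient in a polynomial \<open>p\<close>
  is given by \<open>lookup p\<close>. Multiplication of polynomials is the convolution product provided
  by \<^theory>\<open>HOL-Library.Poly_Mapping\<close>.\<close>

type_synonym monom4 = "indet \<Rightarrow>\<^sub>0 nat"
type_synonym poly4 = "monom4 \<Rightarrow>\<^sub>0 real"

definition const4 :: "real \<Rightarrow> poly4" where
  "const4 c = Poly_Mapping.single 0 c"

definition ind4 :: "indet \<Rightarrow> poly4" where
  "ind4 v = Poly_Mapping.single (Poly_Mapping.single v 1) 1"

definition mdegree :: "monom4 \<Rightarrow> nat" where
  "mdegree m = Poly_Mapping.lookup m Ind_w + Poly_Mapping.lookup m Ind_x
     + Poly_Mapping.lookup m Ind_y + Poly_Mapping.lookup m Ind_z"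

text \<open>As usual, the zero polynomial is a form of every degree.\<close>

definition is_form :: "nat \<Rightarrow> poly4 \<Rightarrow> bool" where
  "is_form d p \<longleftrightarrow> (\<forall>m \<in> Poly_Mapping.keys p. mdegree m = d)"

text \<open>The coefficients may vanish and the monomials need not be distinct.\<close>

definition trinomial :: "poly4 \<Rightarrow> bool" where
  "trinomial p \<longleftrightarrow> (\<exists>a1 a2 a3 m1 m2 m3.
     p = Poly_Mapping.single m1 a1 + Poly_Mapping.single m2 a2 + Poly_Mapping.single m3 a3)"

definition sum_of_squares_of_trinomials :: "poly4 \<Rightarrow> bool" where
  "sum_of_squares_of_trinomials p \<longleftrightarrow>
     (\<exists>ts. (\<forall>t \<in> set ts. trinomial t) \<and> p = (\<Sum>t\<leftarrow>ts. t ^ 2))"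

end

theory Submission imports Defs "HOL-Analysis.Analysis" begin

text \<open>If the quadratic form \<open>q\<close> with matrix \<open>Q\<close> is not a sum of squares of trinomials, then \<open>Q\<close> lies outside
  the closed convex cone generated by the rank-one matrices of vectors with a zero coordinate, so some
  symmetric \<open>A\<close> has \<open>\<langle>A, Q\<rangle> < 0\<close> while all its principal \<open>3 \<times> 3\<close> submatrices are positive semidefinite; after a
  small perturbation its diagonal is positive. Scaling the variables gives \<open>A\<close> unit diagonal. Then \<open>A\<close> extends
  to a linear functional \<open>L\<close> on all polynomials whose value at a monomial depends only on the parities of its
  exponents: the only value left to choose is the one on the class of \<open>w x y z\<close>, and it can be chosen such that
  \<open>L\<close> is nonnegative on squares of trinomials. Since \<open>L\<close> does not see square factors, the multiplier acts under
  \<open>L\<close> as a positive scalar, and \<open>L p\<close> is a positive multiple of \<open>\<langle>A, Q\<rangle>\<close>.\<close>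

section \<open>Correlation matrices of size three\<close>

text \<open>Positive semidefiniteness of the symmetric matrix with unit diagonal and entries
  \<open>x\<close>, \<open>y\<close>, \<open>z\<close> at positions 12, 13, 23. Reordering the index
  set permutes these entries, and the two transpositions \<open>psd3_swap12\<close> and
  \<open>psd3_swap23\<close> generate all permutations.\<close>

definition psd3 :: "real \<Rightarrow> real \<Rightarrow> real \<Rightarrow> bool" where
  "psd3 x y z \<longleftrightarrow> (\<forall>a b c. 0 \<le> a\<^sup>2 + b\<^sup>2 + c\<^sup>2 + 2 * (x * a * b + y * a * c + z * b * c))"

lemma psd3_swap12: "psd3 y x z" if "psd3 x y z"
  unfolding psd3_def
proof (intro allI)
  fix a b c
  show "0 \<le> a\<^sup>2 + b\<^sup>2 + c\<^sup>2 + 2 * (y * a * b + x * a * c + z * b * c)"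
    using that[unfolded psd3_def, rule_format, of a c b] by (simp add: algebra_simps)
qed

lemma psd3_swap23: "psd3 x z y" if "psd3 x y z"
  unfolding psd3_def
proof (intro allI)
  fix a b c
  show "0 \<le> a\<^sup>2 + b\<^sup>2 + c\<^sup>2 + 2 * (x * a * b + z * a * c + y * b * c)"
    using that[unfolded psd3_def, rule_format, of b a c] by (simp add: algebra_simps)
qed

lemma psd3_abs_le_1:
  assumes "psd3 x y z"
  shows "\<bar>x\<bar> \<le> 1" "\<bar>y\<bar> \<le> 1" "\<bar>z\<bar> \<le> 1"
proof -
  have "\<bar>u\<bar> \<le> 1" if "psd3 u v w" for u v w
  proof -
    have "0 \<le> 2 + 2 * u" "0 \<le> 2 - 2 * u"
      using that[unfolded psd3_def, rule_format, of 1 1 0] that[unfolded psd3_def, rule_format, of 1 "-1" 0]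
      by auto
    then show ?thesis by linarith
  qed
  then show "\<bar>x\<bar> \<le> 1" "\<bar>y\<bar> \<le> 1" "\<bar>z\<bar> \<le> 1"
    using assms psd3_swap12 psd3_swap23 by blast+
qed

lemma binary_form_nonneg_iff:
  fixes p q s :: real
  shows "(\<forall>b c. 0 \<le> p * b\<^sup>2 + q * c\<^sup>2 + 2 * s * b * c) \<longleftrightarrow> 0 \<le> p \<and> 0 \<le> q \<and> s\<^sup>2 \<le> p * q"
proof (intro iffI conjI allI)
  assume *: "\<forall>b c. 0 \<le> p * b\<^sup>2 + q * c\<^sup>2 + 2 * s * b * c"
  show p: "0 \<le> p" using *[rule_format, of 1 0] by simp
  show "0 \<le> q" using *[rule_format, of 0 1] by simp
  show "s\<^sup>2 \<le> p * q"
  proof (cases "p = 0")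
    case True
    have "s = 0"
    proof (rule ccontr)
      assume "s \<noteq> 0"
      \<comment> \<open>At this point the form takes the value -1.\<close>
      then show False
        using *[rule_format, of "- (q + 1) / (2 * s)" 1] True by (simp add: field_simps)
    qed
    then show ?thesis using True by simp
  next
    case False
    \<comment> \<open>At \<open>(-s, p)\<close> the form equals \<open>p\<close> times its
      determinant.\<close>
    have "0 \<le> p * (p * q - s\<^sup>2)"
      using *[rule_format, of "-s" p] by (simp add: algebra_simps power2_eq_square)
    then show ?thesis using False p by (simp add: zero_le_mult_iff)
  qed
next
  fix b c
  assume *: "0 \<le> p \<and> 0 \<le> q \<and> s\<^sup>2 \<le> p * q"
  show "0 \<le> p * b\<^sup>2 + q * c\<^sup>2 + 2 * s * b * c"
  proof (cases "p = 0")
    case True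
    then show ?thesis using * by simp
  next
    case False
    have "p * (p * b\<^sup>2 + q * c\<^sup>2 + 2 * s * b * c) = (p * b + s * c)\<^sup>2 + (p * q - s\<^sup>2) * c\<^sup>2"
      by (simp add: algebra_simps power2_eq_square)
    then have "0 \<le> p * (p * b\<^sup>2 + q * c\<^sup>2 + 2 * s * b * c)"
      using * by simp
    then show ?thesis using False * by (simp add: zero_le_mult_iff)
  qed
qed

text \<open>Completing the square in the first variable leaves a binary form in \<open>b\<close> and
  \<open>c\<close>, the Schur complement of the corner entry, to which
  \<open>binary_form_nonneg_iff\<close> applies.\<close>

lemma psd3_iff:
  "psd3 x y z \<longleftrightarrow> \<bar>x\<bar> \<le> 1 \<and> \<bar>y\<bar> \<le> 1 \<and> (z - x * y)\<^sup>2 \<le> (1 - x\<^sup>2) * (1 - y\<^sup>2)"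
proof -
  have eq: "a\<^sup>2 + b\<^sup>2 + c\<^sup>2 + 2 * (x * a * b + y * a * c + z * b * c) =
      (a + x * b + y * c)\<^sup>2 + ((1 - x\<^sup>2) * b\<^sup>2 + (1 - y\<^sup>2) * c\<^sup>2 + 2 * (z - x * y) * b * c)" for a b c
    by (simp add: algebra_simps power2_eq_square)
  have "psd3 x y z \<longleftrightarrow> (\<forall>b c. 0 \<le> (1 - x\<^sup>2) * b\<^sup>2 + (1 - y\<^sup>2) * c\<^sup>2 + 2 * (z - x * y) * b * c)"
  proof
    assume "psd3 x y z"
    then have *: "0 \<le> (a + x * b + y * c)\<^sup>2 + ((1 - x\<^sup>2) * b\<^sup>2 + (1 - y\<^sup>2) * c\<^sup>2 + 2 * (z - x * y) * b * c)" for a b c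
      unfolding psd3_def eq by blast
    show "\<forall>b c. 0 \<le> (1 - x\<^sup>2) * b\<^sup>2 + (1 - y\<^sup>2) * c\<^sup>2 + 2 * (z - x * y) * b * c"
    proof (intro allI)
      fix b c
      show "0 \<le> (1 - x\<^sup>2) * b\<^sup>2 + (1 - y\<^sup>2) * c\<^sup>2 + 2 * (z - x * y) * b * c"
        using *[where a = "- x * b - y * c" and b = b and c = c] by simp
    qed
  next
    assume "\<forall>b c. 0 \<le> (1 - x\<^sup>2) * b\<^sup>2 + (1 - y\<^sup>2) * c\<^sup>2 + 2 * (z - x * y) * b * c"
    then show "psd3 x y z" unfolding psd3_def eq by simp
  qed
  then show ?thesis
    by (simp only: binary_form_nonneg_iff) (simp add: abs_square_le_1)
qed

text \<open>The determinant condition of \<open>psd3_iff\<close> becomes a bound by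
  \<open>sin \<alpha> * sin \<beta>\<close> on the distance of \<open>z\<close> from
  \<open>cos \<alpha> * cos \<beta>\<close>; the addition formulas identify the ends of that
  interval.\<close>

lemma psd3_cos_iff:
  assumes "0 \<le> \<alpha>" "\<alpha> \<le> pi" "0 \<le> \<beta>" "\<beta> \<le> pi"
  shows "psd3 (cos \<alpha>) (cos \<beta>) z \<longleftrightarrow> cos (\<alpha> + \<beta>) \<le> z \<and> z \<le> cos (\<alpha> - \<beta>)"
proof -
  have "0 \<le> sin \<alpha> * sin \<beta>" using assms by (simp add: sin_ge_zero)
  then have "(z - cos \<alpha> * cos \<beta>)\<^sup>2 \<le> (sin \<alpha> * sin \<beta>)\<^sup>2 \<longleftrightarrow> \<bar>z - cos \<alpha> * cos \<beta>\<bar> \<le> sin \<alpha> * sin \<beta>"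
    by (metis abs_le_square_iff abs_of_nonneg)
  moreover have "(sin \<alpha> * sin \<beta>)\<^sup>2 = (1 - (cos \<alpha>)\<^sup>2) * (1 - (cos \<beta>)\<^sup>2)"
    by (simp add: power_mult_distrib sin_squared_eq)
  ultimately show ?thesis
    by (auto simp: psd3_iff cos_add cos_diff abs_le_iff)
qed

text \<open>Both follow from the lower end in \<open>psd3_cos_iff\<close>, since cosine decreases on
  \<open>{0..pi}\<close>; a sum \<open>\<alpha> + \<beta>\<close> beyond \<open>pi\<close> is first
  reflected to \<open>2 * pi - (\<alpha> + \<beta>)\<close>. The remaining cases only use that
  \<open>\<gamma>\<close> is at most \<open>pi\<close>.\<close>

lemma psd3_cos_triangle:
  assumes "psd3 (cos \<alpha>) (cos \<beta>) (cos \<gamma>)"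
    and "0 \<le> \<alpha>" "\<alpha> \<le> pi" "0 \<le> \<beta>" "\<beta> \<le> pi" "0 \<le> \<gamma>" "\<gamma> \<le> pi"
  shows "\<gamma> \<le> \<alpha> + \<beta>" "\<alpha> + \<beta> + \<gamma> \<le> 2 * pi"
proof -
  have *: "cos (\<alpha> + \<beta>) \<le> cos \<gamma>" using assms psd3_cos_iff by blast
  show "\<gamma> \<le> \<alpha> + \<beta>"
  proof (cases "\<alpha> + \<beta> \<le> pi")
    case True
    then show ?thesis using * assms by (subst (asm) cos_mono_le_eq) auto
  qed (use assms in linarith)
  show "\<alpha> + \<beta> + \<gamma> \<le> 2 * pi"
  proof (cases "\<alpha> + \<beta> \<le> pi")
    case False
    have "cos (2 * pi - (\<alpha> + \<beta>)) \<le> cos \<gamma>" using * by (metis cos_2pi_minus)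
    then show ?thesis using False assms by (subst (asm) cos_mono_le_eq) auto
  qed (use assms in linarith)
qed

lemma cos_le_cos_of_abs_le:
  assumes "\<bar>\<delta>\<bar> \<le> \<sigma>" "\<sigma> \<le> 2 * pi - \<bar>\<delta>\<bar>"
  shows "cos \<sigma> \<le> cos \<delta>"
proof (cases "\<sigma> \<le> pi")
  case True
  have "cos \<sigma> \<le> cos \<bar>\<delta>\<bar>" by (rule cos_monotone_0_pi_le) (use True assms in auto)
  then show ?thesis by simp
next
  case False
  have "cos (2 * pi - \<sigma>) \<le> cos \<bar>\<delta>\<bar>" by (rule cos_monotone_0_pi_le) (use False assms in auto)
  then show ?thesis by (metis cos_2pi_minus cos_abs_real)
qed

text \<open>Two spherical triangles share the side \<open>\<gamma>\<close>; eliminating it from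
  their inequalities bounds \<open>\<alpha> + \<alpha>'\<close> on both sides in terms of
  \<open>\<beta> - \<beta>'\<close>. In the completion problem this puts the lower end of one
  interval below the upper end of another.\<close>

lemma cos_add_le_cos_diff:
  assumes psd: "psd3 (cos \<alpha>) (cos \<beta>) (cos \<gamma>)" "psd3 (cos \<alpha>') (cos \<beta>') (cos \<gamma>)"
    and range: "\<alpha> \<in> {0..pi}" "\<beta> \<in> {0..pi}" "\<gamma> \<in> {0..pi}" "\<alpha>' \<in> {0..pi}" "\<beta>' \<in> {0..pi}"
  shows "cos (\<alpha> + \<alpha>') \<le> cos (\<beta> - \<beta>')"
proof -
  have tri: "z \<le> x + y" "x \<le> y + z" "y \<le> x + z" "x + y + z \<le> 2 * pi"
    if "psd3 (cos x) (cos y) (cos z)" "x \<in> {0..pi}" "y \<in> {0..pi}" "z \<in> {0..pi}" for x y z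
  proof -
    note perm = psd3_swap23[OF psd3_swap12[OF that(1)]] psd3_swap23[OF that(1)]
    show "z \<le> x + y" "x + y + z \<le> 2 * pi" using psd3_cos_triangle[OF that(1)] that(2-4) by simp_all
    show "x \<le> y + z" using psd3_cos_triangle(1)[OF perm(1)] that(2-4) by simp
    show "y \<le> x + z" using psd3_cos_triangle(1)[OF perm(2)] that(2-4) by simp
  qed
  note t = tri[OF psd(1) range(1-3)] tri[OF psd(2) range(4,5,3)]
  show ?thesis
  proof (rule cos_le_cos_of_abs_le)
    show "\<bar>\<beta> - \<beta>'\<bar> \<le> \<alpha> + \<alpha>'"
      using t(1,3,5,7) by (intro abs_leI) linarith+
    have "\<alpha> + \<alpha>' + (\<beta> - \<beta>') \<le> 2 * pi" using t(4,6) by linarith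
    moreover have "\<alpha> + \<alpha>' - (\<beta> - \<beta>') \<le> 2 * pi" using t(2,8) by linarith
    ultimately show "\<alpha> + \<alpha>' \<le> 2 * pi - \<bar>\<beta> - \<beta>'\<bar>" by (simp add: abs_if)
  qed
qed

text \<open>Up to scaling, a symmetric matrix with positive diagonal whose principal \<open>3 \<times> 3\<close> minors are
  positive semidefinite is given by six angles satisfying the four spherical triangle inequalities.
  Each condition on \<open>c\<close> confines it to an interval by \<open>psd3_cos_iff\<close>; the triangle inequalities make these three
  intervals intersect pairwise, so by Helly's theorem on the line they have a common point.\<close>

lemma psd3_completion:
  assumes "psd3 wx wy xy" "psd3 wx wz xz" "psd3 wy wz yz" "psd3 xy xz yz"
  shows "\<exists>c. psd3 wx yz c \<and> psd3 wy xz c \<and> psd3 wz xy c"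
proof -
  have angle: "\<exists>\<theta>\<in>{0..pi}. u = cos \<theta>" if "\<bar>u\<bar> \<le> 1" for u
    by (rule bexI[of _ "arccos u"]) (use that in \<open>auto simp: cos_arccos_abs abs_le_iff arccos_lbound arccos_ubound\<close>)
  obtain a1 where a1: "a1 \<in> {0..pi}" "wx = cos a1" using angle[OF psd3_abs_le_1(1)[OF assms(1)]] by blast
  obtain a2 where a2: "a2 \<in> {0..pi}" "wy = cos a2" using angle[OF psd3_abs_le_1(2)[OF assms(1)]] by blast
  obtain a3 where a3: "a3 \<in> {0..pi}" "wz = cos a3" using angle[OF psd3_abs_le_1(2)[OF assms(2)]] by blast
  obtain b1 where b1: "b1 \<in> {0..pi}" "yz = cos b1" using angle[OF psd3_abs_le_1(3)[OF assms(3)]] by blast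
  obtain b2 where b2: "b2 \<in> {0..pi}" "xz = cos b2" using angle[OF psd3_abs_le_1(3)[OF assms(2)]] by blast
  obtain b3 where b3: "b3 \<in> {0..pi}" "xy = cos b3" using angle[OF psd3_abs_le_1(3)[OF assms(1)]] by blast
  note range = a1(1) a2(1) a3(1) b1(1) b2(1) b3(1) and cos = a1(2) a2(2) a3(2) b1(2) b2(2) b3(2)
  \<comment> \<open>Each face containing \<open>w\<close> is paired with the face \<open>xyz\<close>
    along their common edge, which has to stand last for \<open>cos_add_le_cos_diff\<close>;
    \<open>flip\<close> gives the comparison with the two intervals exchanged.\<close>
  note opp = assms(4)[THEN psd3_swap23, THEN psd3_swap12]
  note psd = assms(1-3)[unfolded cos] opp[THEN psd3_swap23, unfolded cos] opp[unfolded cos]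
    assms(4)[THEN psd3_swap12, unfolded cos]
  note flip = psd[THEN psd3_swap12]
  have diag: "cos (a + b) \<le> cos (a - b)" if "a \<in> {0..pi}" "b \<in> {0..pi}" for a b
    using that by (simp add: cos_add cos_diff sin_ge_zero)
  note le = cos_add_le_cos_diff[OF psd(1,4)] cos_add_le_cos_diff[OF flip(1,4)]
    cos_add_le_cos_diff[OF psd(2,5)] cos_add_le_cos_diff[OF flip(2,5)]
    cos_add_le_cos_diff[OF psd(3,6)] cos_add_le_cos_diff[OF flip(3,6)]
    diag[of a1 b1] diag[of a2 b2] diag[of a3 b3]
  \<comment> \<open>The largest of the three lower ends; by \<open>le\<close> it lies below every
    upper end.\<close>
  define c where "c = Max {cos (a1 + b1), cos (a2 + b2), cos (a3 + b3)}"
  have "psd3 wx yz c \<and> psd3 wy xz c \<and> psd3 wz xy c"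
    unfolding cos using range le by (auto simp: psd3_cos_iff c_def)
  then show ?thesis by blast
qed

section \<open>Linear functionals on polynomials\<close>

definition lin_ext :: "(monom4 \<Rightarrow> real) \<Rightarrow> poly4 \<Rightarrow> real" where
  "lin_ext g p = (\<Sum>m\<in>Poly_Mapping.keys p. Poly_Mapping.lookup p m * g m)"

lemma lin_ext_superset:
  assumes "finite S" "Poly_Mapping.keys p \<subseteq> S"
  shows "lin_ext g p = (\<Sum>m\<in>S. Poly_Mapping.lookup p m * g m)"
  unfolding lin_ext_def
  by (rule sum.mono_neutral_left) (use assms in \<open>auto simp: in_keys_iff\<close>)

lemma lin_ext_zero [simp]: "lin_ext g 0 = 0"
  by (simp add: lin_ext_def)

lemma lin_ext_single [simp]: "lin_ext g (Poly_Mapping.single m a) = a * g m"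
  by (simp add: lin_ext_def)

lemma lin_ext_add: "lin_ext g (p + q) = lin_ext g p + lin_ext g q"
proof -
  let ?S = "Poly_Mapping.keys p \<union> Poly_Mapping.keys q"
  have "lin_ext g (p + q) = (\<Sum>m\<in>?S. Poly_Mapping.lookup (p + q) m * g m)"
    by (rule lin_ext_superset) (auto simp: keys_add)
  also have "\<dots> = (\<Sum>m\<in>?S. Poly_Mapping.lookup p m * g m) + (\<Sum>m\<in>?S. Poly_Mapping.lookup q m * g m)"
    by (simp add: lookup_add distrib_right sum.distrib)
  also have "\<dots> = lin_ext g p + lin_ext g q"
    using lin_ext_superset[of ?S p g] lin_ext_superset[of ?S q g] by simp
  finally show ?thesis .
qed

lemma lin_ext_sum: "lin_ext g (\<Sum>i\<in>I. f i) = (\<Sum>i\<in>I. lin_ext g (f i))"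
  by (induction I rule: infinite_finite_induct) (simp_all add: lin_ext_add)

lemma lin_ext_sum_list: "lin_ext g (\<Sum>t\<leftarrow>ts. f t) = (\<Sum>t\<leftarrow>ts. lin_ext g (f t))"
  by (induction ts) (simp_all add: lin_ext_add)

lemma poly_mapping_eq_sum_single:
  "p = (\<Sum>m\<in>Poly_Mapping.keys p. Poly_Mapping.single m (Poly_Mapping.lookup p m))"
  by (rule poly_mapping_eqI) (simp add: lookup_sum lookup_single when_def in_keys_iff)

text \<open>Applied with \<open>m\<close> the exponent of a squared variable, where it turns each
  term of the multiplier into a scalar.\<close>

lemma lin_ext_single_mult:
  assumes "\<And>n. g (m + n) = c * g n"
  shows "lin_ext g (Poly_Mapping.single m a * q) = a * c * lin_ext g q"
proof -
  have "Poly_Mapping.single m a * q =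
      (\<Sum>n\<in>Poly_Mapping.keys q. Poly_Mapping.single (m + n) (a * Poly_Mapping.lookup q n))"
    by (subst poly_mapping_eq_sum_single[of q]) (simp add: sum_distrib_left mult_single)
  then show ?thesis
    by (simp add: lin_ext_sum assms) (simp add: lin_ext_def sum_distrib_left mult_ac)
qed

section \<open>Forms\<close>

lemma mdegree_add: "mdegree (m + n) = mdegree m + mdegree n"
  by (simp add: mdegree_def lookup_add)

lemma is_form_mult: "is_form (d + e) (p * q)" if "is_form d p" "is_form e q"
  using that keys_mult[of p q] unfolding is_form_def by (fastforce simp: mdegree_add)

lemma is_form_add: "is_form d (p + q)" if "is_form d p" "is_form d q"
  using that keys_add[of p q] unfolding is_form_def by blast

lemma is_form_power: "is_form (r * d) (p ^ r)" if "is_form d p"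
proof (induction r)
  case 0
  then show ?case by (simp add: is_form_def mdegree_def)
next
  case (Suc r)
  then show ?case using is_form_mult[OF that Suc] by simp
qed

section \<open>Quadratic forms and their matrices\<close>

definition expo :: "indet \<Rightarrow> monom4" where
  "expo v = Poly_Mapping.single v 1"

lemma lookup_expo: "Poly_Mapping.lookup (expo v) u = (1 when v = u)"
  by (simp add: expo_def lookup_single)

lemma expo_eq_iff [simp]: "expo i = expo j \<longleftrightarrow> i = j"
proof
  assume *: "expo i = expo j"
  show "i = j"
    using arg_cong[OF *, of "\<lambda>m. Poly_Mapping.lookup m i"] by (auto simp: lookup_expo when_def split: if_splits)
qed simp

lemma mdegree_expo [simp]: "mdegree (expo i) = 1"
  by (cases i) (simp_all add: mdegree_def lookup_expo)

lemma const4_mult_ind4_square: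
  "const4 c * ind4 v ^ 2 = Poly_Mapping.single (expo v + expo v) c"
  by (simp add: const4_def ind4_def expo_def power2_eq_square mult_single)

lemma is_form_const4_mult_ind4_square: "is_form 2 (const4 c * ind4 v ^ 2)"
  by (simp add: const4_mult_ind4_square is_form_def mdegree_add)

lemma UNIV_indet: "(UNIV :: indet set) = {Ind_w, Ind_x, Ind_y, Ind_z}"
  by (auto intro: indet.exhaust)

instance indet :: finite
  by standard (simp add: UNIV_indet)

definition quad_form :: "real ^ indet ^ indet \<Rightarrow> poly4" where
  "quad_form M = (\<Sum>i\<in>UNIV. \<Sum>j\<in>UNIV. Poly_Mapping.single (expo i + expo j) (M $ i $ j))"

lemma lookup_quad_form:
  "Poly_Mapping.lookup (quad_form M) m = (\<Sum>i\<in>UNIV. \<Sum>j\<in>UNIV. M $ i $ j when expo i + expo j = m)"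
  by (simp add: quad_form_def lookup_sum lookup_single)

lemma quad_form_add: "quad_form (M + N) = quad_form M + quad_form N"
  by (simp add: quad_form_def single_add sum.distrib)

lemma quad_form_scaleR: "quad_form (c *\<^sub>R M) = Poly_Mapping.single 0 c * quad_form M"
  by (simp add: quad_form_def sum_distrib_left mult_single)

definition outer :: "real ^ indet \<Rightarrow> real ^ indet ^ indet" where
  "outer v = (\<chi> i j. v $ i * v $ j)"

lemma quad_form_outer:
  "quad_form (outer v) = (\<Sum>i\<in>UNIV. Poly_Mapping.single (expo i) (v $ i)) ^ 2"
  by (simp add: quad_form_def outer_def power2_eq_square sum_product mult_single)

lemma trinomial_linear_form:
  assumes "v $ k = 0"
  shows "trinomial (\<Sum>i\<in>UNIV. Poly_Mapping.single (expo i) (v $ i))"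
proof -
  let ?L = "\<Sum>i\<in>UNIV. Poly_Mapping.single (expo i) (v $ i)"
  let ?s = "\<lambda>i. Poly_Mapping.single (expo i) (v $ i)"
  have *: "trinomial (?s i1 + ?s i2 + ?s i3)" for i1 i2 i3
    unfolding trinomial_def by blast
  have sum: "?L = ?s Ind_w + ?s Ind_x + ?s Ind_y + ?s Ind_z"
    by (simp add: UNIV_indet add.assoc)
  show ?thesis
  proof (cases k)
    case Ind_w
    then have "?L = ?s Ind_x + ?s Ind_y + ?s Ind_z" using assms sum by simp
    then show ?thesis using * by simp
  next
    case Ind_x
    then have "?L = ?s Ind_w + ?s Ind_y + ?s Ind_z" using assms sum by simp
    then show ?thesis using * by simp
  next
    case Ind_y
    then have "?L = ?s Ind_w + ?s Ind_x + ?s Ind_z" using assms sum by simp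
    then show ?thesis using * by simp
  next
    case Ind_z
    then have "?L = ?s Ind_w + ?s Ind_x + ?s Ind_y" using assms sum by simp
    then show ?thesis using * by simp
  qed
qed

section \<open>Closure properties of sums of squares, and recovery of the matrix from the
  form\<close>

lemma sum_of_squares_of_trinomials_add:
  "sum_of_squares_of_trinomials (p + q)"
  if "sum_of_squares_of_trinomials p" "sum_of_squares_of_trinomials q"
proof -
  from that obtain ts us where "\<forall>t\<in>set ts. trinomial t" "p = (\<Sum>t\<leftarrow>ts. t ^ 2)"
    "\<forall>t\<in>set us. trinomial t" "q = (\<Sum>t\<leftarrow>us. t ^ 2)"
    unfolding sum_of_squares_of_trinomials_def by blast
  then show ?thesis
    unfolding sum_of_squares_of_trinomials_def by (intro exI[of _ "ts @ us"]) auto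
qed

lemma trinomial_scale: "trinomial (Poly_Mapping.single 0 c * t)" if "trinomial t"
proof -
  from that obtain a1 a2 a3 m1 m2 m3 where
    "t = Poly_Mapping.single m1 a1 + Poly_Mapping.single m2 a2 + Poly_Mapping.single m3 a3"
    unfolding trinomial_def by blast
  then have "Poly_Mapping.single 0 c * t = Poly_Mapping.single m1 (c * a1)
      + Poly_Mapping.single m2 (c * a2) + Poly_Mapping.single m3 (c * a3)"
    by (simp add: distrib_left mult_single)
  then show ?thesis unfolding trinomial_def by blast
qed

lemma sum_of_squares_of_trinomials_scale:
  assumes "sum_of_squares_of_trinomials p" "0 \<le> c"
  shows "sum_of_squares_of_trinomials (Poly_Mapping.single 0 c * p)"
proof -
  let ?s = "Poly_Mapping.single 0 (sqrt c) :: poly4"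
  obtain ts where ts: "\<forall>t\<in>set ts. trinomial t" "p = (\<Sum>t\<leftarrow>ts. t ^ 2)"
    using assms unfolding sum_of_squares_of_trinomials_def by blast
  have "Poly_Mapping.single 0 c = ?s ^ 2"
    using assms by (simp add: power2_eq_square mult_single)
  then have "Poly_Mapping.single 0 c * p = (\<Sum>t\<leftarrow>map (\<lambda>t. ?s * t) ts. t ^ 2)"
    by (simp add: ts sum_list_const_mult[symmetric] power_mult_distrib o_def)
  moreover have "\<forall>t\<in>set (map (\<lambda>t. ?s * t) ts). trinomial t"
    using ts trinomial_scale by auto
  ultimately show ?thesis unfolding sum_of_squares_of_trinomials_def by blast
qed

lemma monomial_degree_2E:
  assumes "mdegree m = 2"
  obtains i j where "m = expo i + expo j"
proof -
  have pos: "\<exists>i. 0 < Poly_Mapping.lookup n i" if "mdegree n \<noteq> 0" for n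
    using that unfolding mdegree_def by auto
  have split: "\<exists>i n'. n = expo i + n'" if "mdegree n \<noteq> 0" for n
  proof -
    obtain i where "0 < Poly_Mapping.lookup n i" using pos[OF \<open>mdegree n \<noteq> 0\<close>] by blast
    \<comment> \<open>The truncated subtraction is exact because the exponent of \<open>i\<close> is
      positive.\<close>
    then have "n = expo i + (n - expo i)"
      by (intro poly_mapping_eqI) (auto simp: lookup_add lookup_minus lookup_expo when_def)
    then show ?thesis by blast
  qed
  obtain i n where n: "m = expo i + n" using split[of m] assms by auto
  then have "mdegree n = 1" using assms by (simp add: mdegree_add)
  then obtain j k where k: "n = expo j + k" using split[of n] by auto
  then have "mdegree k = 0" using \<open>mdegree n = 1\<close> by (simp add: mdegree_add)
  then have "k = 0"
    by (intro poly_mapping_eqI, rename_tac v, case_tac v) (simp_all add: mdegree_def)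
  then show ?thesis using that n k by simp
qed

lemma expo_add_eq_iff: "expo i + expo j = expo k + expo l \<longleftrightarrow> i = k \<and> j = l \<or> i = l \<and> j = k"
proof
  assume *: "expo i + expo j = expo k + expo l"
  have "(1 when i = v) + (1 when j = v) = ((1::nat) when k = v) + (1 when l = v)" for v
    using arg_cong[OF *, of "\<lambda>m. Poly_Mapping.lookup m v"] by (simp add: lookup_add lookup_expo)
  from this[of i] this[of j] this[of k] this[of l]
  show "i = k \<and> j = l \<or> i = l \<and> j = k"
    by (auto simp: when_def split: if_splits)
qed (auto simp: add.commute)

text \<open>An off-diagonal monomial collects the entries \<open>(i, j)\<close> and
  \<open>(j, i)\<close> in \<open>quad_form\<close>, hence the factor 1/2.\<close>

definition coeff_matrix :: "poly4 \<Rightarrow> real ^ indet ^ indet" where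
  "coeff_matrix q = (\<chi> i j. (if i = j then 1 else 1/2) * Poly_Mapping.lookup q (expo i + expo j))"

lemma quad_form_coeff_matrix:
  assumes "is_form 2 q"
  shows "quad_form (coeff_matrix q) = q"
proof (rule poly_mapping_eqI)
  fix m
  show "Poly_Mapping.lookup (quad_form (coeff_matrix q)) m = Poly_Mapping.lookup q m"
  proof (cases "mdegree m = 2")
    case True
    then obtain k l where m: "m = expo k + expo l" by (rule monomial_degree_2E)
    have sym: "Poly_Mapping.lookup q (expo l + expo k) = Poly_Mapping.lookup q (expo k + expo l)"
      by (simp add: add.commute)
    show ?thesis unfolding m lookup_quad_form using sym
      by (cases k; cases l) (simp_all add: coeff_matrix_def UNIV_indet expo_add_eq_iff)
  next
    case False
    have "mdegree (expo i + expo j) = 2" for i j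
      by (simp add: mdegree_add)
    then have "expo i + expo j \<noteq> m" for i j using False by blast
    then have "Poly_Mapping.lookup (quad_form (coeff_matrix q)) m = 0"
      by (simp add: lookup_quad_form)
    moreover have "Poly_Mapping.lookup q m = 0"
      using assms False unfolding is_form_def by (auto simp: in_keys_iff)
    ultimately show ?thesis by simp
  qed
qed

section \<open>Separation\<close>

lemma inner_matrix: "(A :: real ^ indet ^ indet) \<bullet> M = (\<Sum>i\<in>UNIV. \<Sum>j\<in>UNIV. A $ i $ j * M $ i $ j)"
  by (simp add: inner_vec_def)

text \<open>A symmetric \<open>M\<close> does not distinguish \<open>a\<close> from its transpose,
  and the identity matrix pairs with \<open>M\<close> to the trace.\<close>

lemma inner_symmetrised:
  fixes a M :: "real ^ indet ^ indet"
  assumes "\<And>i j. M $ i $ j = M $ j $ i"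
  shows "(\<chi> i j. (a $ i $ j + a $ j $ i) / 2 + (if i = j then \<epsilon> else 0)) \<bullet> M
    = a \<bullet> M + \<epsilon> * (\<Sum>i\<in>UNIV. M $ i $ i)"
proof -
  have "(\<Sum>i\<in>UNIV. \<Sum>j\<in>UNIV. a $ j $ i * M $ i $ j) = (\<Sum>i\<in>UNIV. \<Sum>j\<in>UNIV. a $ i $ j * M $ j $ i)"
    by (rule sum.swap)
  also have "\<dots> = a \<bullet> M"
    using assms by (simp add: inner_matrix)
  finally have *: "(\<Sum>i\<in>UNIV. \<Sum>j\<in>UNIV. a $ j $ i * M $ i $ j) = a \<bullet> M" .
  have "(if i = j then \<epsilon> else 0) * M $ i $ j = (if i = j then \<epsilon> * M $ i $ i else 0)" for i j
    by simp
  then have "(\<chi> i j. (a $ i $ j + a $ j $ i) / 2 + (if i = j then \<epsilon> else 0)) \<bullet> M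
    = (\<Sum>i\<in>UNIV. \<Sum>j\<in>UNIV. a $ i $ j * M $ i $ j) / 2 + (\<Sum>i\<in>UNIV. \<Sum>j\<in>UNIV. a $ j $ i * M $ i $ j) / 2
      + \<epsilon> * (\<Sum>i\<in>UNIV. M $ i $ i)"
    unfolding inner_matrix
    by (simp add: distrib_right add_divide_distrib sum.distrib sum_divide_distrib sum_distrib_left sum.delta)
  then show ?thesis using * by (simp add: inner_matrix)
qed

text \<open>Restricting to unit vectors makes the set of generators compact and gives them trace 1,
  without changing the cone they generate.\<close>

definition unit_outer3 :: "(real ^ indet ^ indet) set" where
  "unit_outer3 = outer ` (\<Union>k. sphere 0 1 \<inter> {v. v $ k = 0})"

lemma compact_unit_outer3: "compact unit_outer3"
proof -
  have "compact (sphere 0 1 \<inter> {v :: real ^ indet. v $ k = 0})" for k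
    by (intro compact_Int_closed compact_sphere closed_Collect_eq continuous_intros)
  then have "compact (\<Union>k. sphere 0 1 \<inter> {v :: real ^ indet. v $ k = 0})"
    by (intro compact_UN) auto
  moreover have "continuous_on S outer" for S
    unfolding outer_def by (intro continuous_intros)
  ultimately show ?thesis
    unfolding unit_outer3_def by (rule compact_continuous_image[rotated])
qed

lemma trace_outer: "(\<Sum>i\<in>UNIV. outer v $ i $ i) = (norm v)\<^sup>2"
  by (simp add: outer_def power2_norm_eq_inner inner_vec_def)

text \<open>Trace 1 is an affine condition, so it passes from the generators to their hull.\<close>

lemma zero_notin_hull_unit_outer3: "0 \<notin> convex hull unit_outer3"
proof -
  let ?T = "{M :: real ^ indet ^ indet. (\<Sum>i\<in>UNIV. M $ i $ i) = 1}"
  have "convex ?T"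
    by (auto simp: convex_def sum.distrib sum_distrib_left[symmetric])
  moreover have "unit_outer3 \<subseteq> ?T"
    by (auto simp: unit_outer3_def trace_outer)
  ultimately have "convex hull unit_outer3 \<subseteq> ?T" by (rule hull_minimal[rotated])
  then show ?thesis by auto
qed

abbreviation outer3_cone :: "(real ^ indet ^ indet) set" where
  "outer3_cone \<equiv> conic hull (convex hull unit_outer3)"

text \<open>The conic hull of a compact set is closed as soon as the set avoids 0.\<close>

lemma closed_outer3_cone: "closed outer3_cone"
  by (intro closed_conic_hull disjI2 conjI compact_convex_hull compact_unit_outer3 zero_notin_hull_unit_outer3)

lemma convex_outer3_cone: "convex outer3_cone"
  by (intro convex_conic_hull convex_convex_hull)

text \<open>A witness that the hull is nonempty, so that its conic hull contains 0.\<close>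

lemma outer_axis_mem: "outer (axis Ind_w 1) \<in> unit_outer3"
  unfolding unit_outer3_def by (intro imageI UN_I[of Ind_x]) (auto simp: norm_axis_1, simp add: axis_def)

lemma outer_mem_cone:
  assumes "v $ k = 0"
  shows "outer v \<in> outer3_cone"
proof (cases "v = 0")
  case True
  have "convex hull unit_outer3 \<noteq> {}" using outer_axis_mem by auto
  moreover have "outer v = 0" using True by (simp add: outer_def vec_eq_iff)
  ultimately show ?thesis by simp
next
  case False
  let ?u = "(1 / norm v) *\<^sub>R v"
  have "outer ?u \<in> unit_outer3"
    unfolding unit_outer3_def by (intro imageI UN_I[of k]) (use assms False in auto)
  then have "outer ?u \<in> convex hull unit_outer3" by (rule hull_inc)
  then have "(norm v)\<^sup>2 *\<^sub>R outer ?u \<in> outer3_cone"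
    unfolding conic_hull_explicit by fastforce
  moreover have "(norm v)\<^sup>2 *\<^sub>R outer ?u = outer v"
    using False by (simp add: outer_def vec_eq_iff power2_eq_square)
  ultimately show ?thesis by simp
qed

text \<open>The matrices with this property form a convex cone, and it contains the generators: each
  of them yields the square of a linear form with a vanishing coefficient.\<close>

lemma sum_of_squares_of_cone:
  assumes "M \<in> outer3_cone"
  shows "sum_of_squares_of_trinomials (quad_form M)"
proof -
  let ?P = "{M. sum_of_squares_of_trinomials (quad_form M)}"
  have scale: "c *\<^sub>R M \<in> ?P" if "M \<in> ?P" "0 \<le> c" for c M
    using that sum_of_squares_of_trinomials_scale by (simp add: quad_form_scaleR)
  have "convex ?P"
    unfolding convex_def using scale sum_of_squares_of_trinomials_add
    by (simp add: quad_form_add)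
  moreover have "unit_outer3 \<subseteq> ?P"
  proof
    fix M assume "M \<in> unit_outer3"
    then obtain v k where v: "M = outer v" "v $ k = 0" unfolding unit_outer3_def by auto
    show "M \<in> ?P"
      unfolding sum_of_squares_of_trinomials_def mem_Collect_eq
      by (rule exI[of _ "[\<Sum>i\<in>UNIV. Poly_Mapping.single (expo i) (v $ i)]"])
        (use v trinomial_linear_form in \<open>simp add: quad_form_outer\<close>)
  qed
  ultimately have "convex hull unit_outer3 \<subseteq> ?P" by (rule hull_minimal[rotated])
  moreover have "conic ?P" unfolding conic_def using scale by blast
  ultimately have "outer3_cone \<subseteq> ?P" by (rule hull_minimal)
  then show ?thesis using assms by blast
qed

lemma separating_matrix:
  assumes "is_form 2 q" "\<not> sum_of_squares_of_trinomials q"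
  obtains A :: "real ^ indet ^ indet" where
    "\<And>i j. A $ i $ j = A $ j $ i" "\<And>i. 0 < A $ i $ i"
    "\<forall>v k. v $ k = 0 \<longrightarrow> 0 \<le> A \<bullet> outer v" "A \<bullet> coeff_matrix q < 0"
proof -
  let ?Q = "coeff_matrix q"
  have "?Q \<notin> outer3_cone"
    using assms sum_of_squares_of_cone quad_form_coeff_matrix by metis
  then obtain a b where ab: "a \<bullet> ?Q < b" "\<And>M. M \<in> outer3_cone \<Longrightarrow> b < a \<bullet> M"
    using separating_hyperplane_closed_point[OF convex_outer3_cone closed_outer3_cone] by blast
  have "outer 0 \<in> outer3_cone" by (rule outer_mem_cone) simp
  moreover have "outer 0 = 0" by (simp add: outer_def vec_eq_iff)
  ultimately have b: "b < 0" using ab(2)[of 0] by simp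
  have nonneg: "0 \<le> a \<bullet> M" if "M \<in> outer3_cone" for M
  proof (rule ccontr)
    assume neg: "\<not> 0 \<le> a \<bullet> M"
    \<comment> \<open>This nonnegative multiple of \<open>M\<close> pairs with \<open>a\<close> to
      exactly \<open>b\<close>, against the strict separation.\<close>
    have "(b / (a \<bullet> M)) *\<^sub>R M \<in> outer3_cone"
      using that b neg by (intro conicD[OF conic_conic_hull]) (auto simp: divide_nonpos_neg)
    from ab(2)[OF this] show False using neg by simp
  qed
  \<comment> \<open>Small enough that the trace term uses up at most half of the negative value
    \<open>a \<bullet> ?Q\<close>.\<close>
  define \<epsilon> where "\<epsilon> = - (a \<bullet> ?Q) / (2 * (\<bar>\<Sum>i\<in>UNIV. ?Q $ i $ i\<bar> + 1))"
  have \<epsilon>: "0 < \<epsilon>" unfolding \<epsilon>_def using ab b by (intro divide_pos_pos) auto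
  define A :: "real ^ indet ^ indet" where
    "A = (\<chi> i j. (a $ i $ j + a $ j $ i) / 2 + (if i = j then \<epsilon> else 0))"
  have inner_A: "A \<bullet> M = a \<bullet> M + \<epsilon> * (\<Sum>i\<in>UNIV. M $ i $ i)" if "\<And>i j. M $ i $ j = M $ j $ i" for M
    unfolding A_def by (rule inner_symmetrised) (rule that)
  show thesis
  proof
    show "A $ i $ j = A $ j $ i" for i j by (simp add: A_def)
    show "0 < A $ i $ i" for i
    proof -
      obtain k where "k \<noteq> i" by (metis indet.distinct(1))
      then have "outer (axis i 1) \<in> outer3_cone" by (intro outer_mem_cone[of _ k]) (simp add: axis_def)
      then have "0 \<le> a \<bullet> outer (axis i 1)" by (rule nonneg)
      also have "a \<bullet> outer (axis i 1) = a $ i $ i"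
        by (cases i) (simp_all add: inner_matrix outer_def axis_def UNIV_indet)
      finally show ?thesis using \<epsilon> by (simp add: A_def)
    qed
    show "\<forall>v k. v $ k = 0 \<longrightarrow> 0 \<le> A \<bullet> outer v"
    proof (intro allI impI)
      fix v :: "real ^ indet" and k
      assume vk: "v $ k = 0"
      have "A \<bullet> outer v = a \<bullet> outer v + \<epsilon> * (norm v)\<^sup>2"
        by (subst inner_A) (simp_all add: trace_outer, simp add: outer_def)
      then show "0 \<le> A \<bullet> outer v" using nonneg[OF outer_mem_cone[OF vk]] \<epsilon> by simp
    qed
    have "A \<bullet> ?Q = a \<bullet> ?Q + \<epsilon> * (\<Sum>i\<in>UNIV. ?Q $ i $ i)"
      by (rule inner_A) (simp add: coeff_matrix_def add.commute)
    also have "\<dots> \<le> a \<bullet> ?Q + \<epsilon> * (\<bar>\<Sum>i\<in>UNIV. ?Q $ i $ i\<bar> + 1)"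
      using \<epsilon> by (intro add_left_mono mult_left_mono) auto
    also have "\<dots> = (a \<bullet> ?Q) / 2"
      by (simp add: \<epsilon>_def field_simps add_nonneg_eq_0_iff)
    also have "\<dots> < 0" using ab b by simp
    finally show "A \<bullet> ?Q < 0" .
  qed
qed

section \<open>The functional\<close>

text \<open>These patterns arise when two parity classes agree, one is trivial, or two have odd
  degree.\<close>

lemma psd3_degenerate [simp]:
  "psd3 1 x x \<longleftrightarrow> \<bar>x\<bar> \<le> 1" "psd3 x 1 x \<longleftrightarrow> \<bar>x\<bar> \<le> 1" "psd3 x x 1 \<longleftrightarrow> \<bar>x\<bar> \<le> 1"
  "psd3 0 0 x \<longleftrightarrow> \<bar>x\<bar> \<le> 1" "psd3 0 x 0 \<longleftrightarrow> \<bar>x\<bar> \<le> 1" "psd3 x 0 0 \<longleftrightarrow> \<bar>x\<bar> \<le> 1"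
  using abs_square_le_1[of x] by (auto simp: psd3_iff power2_eq_square)

text \<open>Extends a correlation matrix \<open>B\<close>, read as a function on the parity classes of the monomials
  \<open>w x, w y, \<dots>\<close>, to all sixteen parity classes of exponent vectors: \<open>1\<close> on squares, \<open>c\<close> on the class of
  \<open>w x y z\<close>, and \<open>0\<close> on monomials of odd degree.\<close>

definition parity_ext :: "(indet \<Rightarrow> indet \<Rightarrow> real) \<Rightarrow> real \<Rightarrow> (indet \<Rightarrow> bool) \<Rightarrow> real" where
  "parity_ext B c P =
    (if P Ind_w then
      if P Ind_x then if P Ind_y then if P Ind_z then c else 0 else if P Ind_z then 0 else B Ind_w Ind_x
      else if P Ind_y then if P Ind_z then 0 else B Ind_w Ind_y
      else if P Ind_z then B Ind_w Ind_z else 0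
    else
      if P Ind_x then if P Ind_y then if P Ind_z then 0 else B Ind_x Ind_y
        else if P Ind_z then B Ind_x Ind_z else 0
      else if P Ind_y then if P Ind_z then B Ind_y Ind_z else 0
      else if P Ind_z then 0 else 1)"

text \<open>The seven nontrivial classes of even degree form a Fano plane. Four of its lines are the
  triangles covered by \<open>tri\<close>, and the three lines through the class of
  \<open>w x y z\<close> are the conditions on \<open>c\<close>. All other triples are
  degenerate.\<close>

lemma psd3_parity_ext:
  assumes tri: "\<And>i j k. i \<noteq> j \<Longrightarrow> i \<noteq> k \<Longrightarrow> j \<noteq> k \<Longrightarrow> psd3 (B i j) (B i k) (B j k)"
    and c: "psd3 (B Ind_w Ind_x) (B Ind_y Ind_z) c" "psd3 (B Ind_w Ind_y) (B Ind_x Ind_z) c"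
      "psd3 (B Ind_w Ind_z) (B Ind_x Ind_y) c"
  shows "psd3 (parity_ext B c P) (parity_ext B c Q) (parity_ext B c (\<lambda>i. P i \<noteq> Q i))"
proof -
  note t = tri[of Ind_w Ind_x Ind_y] tri[of Ind_w Ind_x Ind_z] tri[of Ind_w Ind_y Ind_z] tri[of Ind_x Ind_y Ind_z] c
  \<comment> \<open>The facts are closed under all six orders of the arguments, so that the case
    split below always finds the order it meets.\<close>
  note t0 = t[simplified]
  note t1 = t0 t0[THEN psd3_swap12]
  note t2 = t1 t1[THEN psd3_swap23]
  note t3 = t2 t2[THEN psd3_swap12]
  note le = psd3_abs_le_1[OF t0(1)] psd3_abs_le_1[OF t0(2)] psd3_abs_le_1[OF t0(3)]
    psd3_abs_le_1[OF t0(4)] psd3_abs_le_1[OF c(1)]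
  show ?thesis
    by (cases "P Ind_w"; cases "P Ind_x"; cases "P Ind_y"; cases "P Ind_z";
        cases "Q Ind_w"; cases "Q Ind_x"; cases "Q Ind_y"; cases "Q Ind_z";
        simp add: parity_ext_def t3 le)
qed

text \<open>The form of \<open>A\<close> is tested on a vector supported on \<open>i\<close>,
  \<open>j\<close>, \<open>k\<close> whose coordinates are divided by the roots of the diagonal
  entries. The fourth coordinate is zero, so \<open>psd\<close> applies.\<close>

lemma normalised_triangle:
  fixes A :: "real ^ indet ^ indet"
  assumes sym: "\<And>i j. A $ i $ j = A $ j $ i" and pos: "\<And>i. 0 < A $ i $ i"
    and psd: "\<forall>v k. v $ k = 0 \<longrightarrow> 0 \<le> A \<bullet> outer v"
    and B: "\<And>i j. B i j = A $ i $ j / (sqrt (A $ i $ i) * sqrt (A $ j $ j))"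
    and ijk: "i \<noteq> j" "i \<noteq> k" "j \<noteq> k"
  shows "psd3 (B i j) (B i k) (B j k)"
  unfolding psd3_def
proof (intro allI)
  fix a b c :: real
  define s where "s = (\<lambda>i. sqrt (A $ i $ i))"
  have s: "0 < s i" "A $ i $ i = s i * s i" for i using pos[of i] by (simp_all add: s_def)
  define v :: "real ^ indet" where
    "v = (\<chi> u. if u = i then a / s i else if u = j then b / s j else if u = k then c / s k else 0)"
  have vz: "v $ u = 0" if "u \<notin> {i, j, k}" for u using that by (simp add: v_def)
  obtain l where "l \<notin> {i, j, k}" by (cases i; cases j; cases k) auto
  then have "0 \<le> A \<bullet> outer v" using psd vz by blast
  also have "A \<bullet> outer v = (\<Sum>p\<in>{i, j, k}. \<Sum>q\<in>{i, j, k}. A $ p $ q * (v $ p * v $ q))"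
  proof -
    have "(\<Sum>q\<in>UNIV. A $ p $ q * (v $ p * v $ q)) = (\<Sum>q\<in>{i, j, k}. A $ p $ q * (v $ p * v $ q))" for p
      by (rule sum.mono_neutral_right) (use vz in auto)
    moreover have "(\<Sum>p\<in>UNIV. \<Sum>q\<in>{i, j, k}. A $ p $ q * (v $ p * v $ q)) =
        (\<Sum>p\<in>{i, j, k}. \<Sum>q\<in>{i, j, k}. A $ p $ q * (v $ p * v $ q))"
      by (rule sum.mono_neutral_right) (use vz in auto)
    ultimately show ?thesis by (simp add: inner_matrix outer_def)
  qed
  also have "\<dots> = a\<^sup>2 + b\<^sup>2 + c\<^sup>2 + 2 * (B i j * a * b + B i k * a * c + B j k * b * c)"
  proof -
    have [simp]: "v $ i = a / s i" "v $ j = b / s j" "v $ k = c / s k" using ijk by (auto simp: v_def)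
    have B': "B p q = A $ p $ q / (s p * s q)" for p q by (simp add: B s_def)
    have [simp]: "s u \<noteq> 0" for u using s(1)[of u] by simp
    show ?thesis using ijk sym[of j i] sym[of k i] sym[of k j]
      by (simp add: B' s(2)) (simp add: field_simps power2_eq_square)
  qed
  finally show "0 \<le> a\<^sup>2 + b\<^sup>2 + c\<^sup>2 + 2 * (B i j * a * b + B i k * a * c + B j k * b * c)" .
qed

lemma lin_ext_trinomial_square:
  "lin_ext g ((Poly_Mapping.single m1 a1 + Poly_Mapping.single m2 a2 + Poly_Mapping.single m3 a3) ^ 2) =
    a1\<^sup>2 * g (m1 + m1) + a2\<^sup>2 * g (m2 + m2) + a3\<^sup>2 * g (m3 + m3)
    + 2 * (a1 * a2 * g (m1 + m2) + a1 * a3 * g (m1 + m3) + a2 * a3 * g (m2 + m3))"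
proof -
  have "m2 + m1 = m1 + m2" "m3 + m1 = m1 + m3" "m3 + m2 = m2 + m3" by (simp_all add: add.commute)
  then show ?thesis
    by (simp add: power2_eq_square distrib_left distrib_right mult_single lin_ext_add)
qed

text \<open>The function \<open>g\<close> is the weight \<open>\<sigma>\<close>, which evaluates the
  monomial at the point \<open>s\<close> and undoes the normalisation, times a function of the
  exponent parities. A square factor leaves the parities alone, so only its weight comes
  out.\<close>

lemma multiplicative_functional:
  fixes A :: "real ^ indet ^ indet"
  assumes sym: "\<And>i j. A $ i $ j = A $ j $ i" and pos: "\<And>i. 0 < A $ i $ i"
    and psd: "\<forall>v k. v $ k = 0 \<longrightarrow> 0 \<le> A \<bullet> outer v"
  obtains g where "\<And>i j. g (expo i + expo j) = A $ i $ j"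
    "\<And>i m. g (expo i + expo i + m) = A $ i $ i * g m"
    "\<And>t. trinomial t \<Longrightarrow> 0 \<le> lin_ext g (t ^ 2)"
proof -
  define s where "s = (\<lambda>i. sqrt (A $ i $ i))"
  have s: "0 < s i" "s i * s i = A $ i $ i" for i using pos[of i] by (simp_all add: s_def)
  define B where "B = (\<lambda>i j. A $ i $ j / (s i * s j))"
  have B: "s i * s j * B i j = A $ i $ j" "s j * s i * B i j = A $ i $ j" for i j
    using s(1)[of i] s(1)[of j] by (simp_all add: B_def)
  have tri: "psd3 (B i j) (B i k) (B j k)" if "i \<noteq> j" "i \<noteq> k" "j \<noteq> k" for i j k
    by (rule normalised_triangle[OF sym pos psd _ that]) (auto simp: B_def s_def)
  obtain c where c: "psd3 (B Ind_w Ind_x) (B Ind_y Ind_z) c" "psd3 (B Ind_w Ind_y) (B Ind_x Ind_z) c"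
      "psd3 (B Ind_w Ind_z) (B Ind_x Ind_y) c"
    using psd3_completion[of "B Ind_w Ind_x" "B Ind_w Ind_y" "B Ind_x Ind_y" "B Ind_w Ind_z" "B Ind_x Ind_z"
      "B Ind_y Ind_z"] tri by auto
  define \<sigma> where "\<sigma> = (\<lambda>m :: monom4. \<Prod>i\<in>UNIV. s i ^ Poly_Mapping.lookup m i)"
  define F where "F = parity_ext B c"
  define odds where "odds = (\<lambda>(m :: monom4) i. odd (Poly_Mapping.lookup m i))"
  define g where "g = (\<lambda>m. \<sigma> m * F (odds m))"
  have \<sigma>_add: "\<sigma> (m + n) = \<sigma> m * \<sigma> n" for m n
    by (simp add: \<sigma>_def lookup_add power_add prod.distrib)
  have \<sigma>_expo: "\<sigma> (expo i) = s i" for i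
    by (cases i) (simp_all add: \<sigma>_def lookup_expo UNIV_indet)
  have odds_add: "odds (m + n) = (\<lambda>i. odds m i \<noteq> odds n i)" for m n
    by (auto simp: odds_def lookup_add)
  have odds_expo: "odds (expo i) = (\<lambda>j. i = j)" for i
    by (auto simp: odds_def lookup_expo when_def)
  have g_expo: "g (expo i + expo j) = A $ i $ j" for i j
  proof -
    have "F (odds (expo i + expo j)) = (if i = j then 1 else B i j)"
      using sym by (cases i; cases j) (simp_all add: odds_add odds_expo F_def parity_ext_def B_def mult.commute)
    then show ?thesis by (simp add: g_def \<sigma>_add \<sigma>_expo s B)
  qed
  have g_square: "g (expo i + expo i + m) = A $ i $ i * g m" for i m
    by (simp add: g_def \<sigma>_add \<sigma>_expo odds_add s)
  have F0: "F (\<lambda>i. False) = 1" by (simp add: F_def parity_ext_def)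
  have "0 \<le> lin_ext g (t ^ 2)" if "trinomial t" for t
  proof -
    obtain a1 a2 a3 m1 m2 m3 where t: "t = Poly_Mapping.single m1 a1 + Poly_Mapping.single m2 a2 + Poly_Mapping.single m3 a3"
      using \<open>trinomial t\<close> unfolding trinomial_def by blast
    define u1 u2 u3 where u: "u1 = a1 * \<sigma> m1" "u2 = a2 * \<sigma> m2" "u3 = a3 * \<sigma> m3"
    \<comment> \<open>The common \<open>m1\<close> cancels modulo 2, so the three cross terms have
      parity classes of the shape treated in \<open>psd3_parity_ext\<close>.\<close>
    have "(\<lambda>i. odds (m1 + m2) i \<noteq> odds (m1 + m3) i) = odds (m2 + m3)"
      by (auto simp: odds_add)
    then have "psd3 (F (odds (m1 + m2))) (F (odds (m1 + m3))) (F (odds (m2 + m3)))"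
      using psd3_parity_ext[OF tri c, of "odds (m1 + m2)" "odds (m1 + m3)"] by (simp add: F_def)
    then have "0 \<le> u1\<^sup>2 + u2\<^sup>2 + u3\<^sup>2
        + 2 * (F (odds (m1 + m2)) * u1 * u2 + F (odds (m1 + m3)) * u1 * u3 + F (odds (m2 + m3)) * u2 * u3)"
      unfolding psd3_def by blast
    also have "\<dots> = lin_ext g (t ^ 2)"
    proof -
      have gg: "g (m + m) = (\<sigma> m)\<^sup>2" for m
        by (simp add: g_def \<sigma>_add odds_add F0 power2_eq_square)
      show ?thesis
        unfolding t lin_ext_trinomial_square gg u
        by (simp add: g_def \<sigma>_add power_mult_distrib mult_ac)
    qed
    finally show ?thesis .
  qed
  then show thesis using that g_expo g_square by blast
qed

lemma lin_ext_quad_form: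
  assumes "\<And>i j. g (expo i + expo j) = A $ i $ j"
  shows "lin_ext g (quad_form M) = A \<bullet> M"
  by (simp add: quad_form_def lin_ext_sum assms inner_matrix mult.commute)

theorem proposition7p1:
  fixes q :: poly4 and r :: nat and l1 l2 l3 l4 :: real
  assumes "is_form 2 q"
    and "\<not> sum_of_squares_of_trinomials q"
    and "\<not> (l1 = 0 \<and> l2 = 0 \<and> l3 = 0 \<and> l4 = 0)"
  defines "p \<equiv> (const4 (l1 ^ 2) * ind4 Ind_w ^ 2 + const4 (l2 ^ 2) * ind4 Ind_x ^ 2
      + const4 (l3 ^ 2) * ind4 Ind_y ^ 2 + const4 (l4 ^ 2) * ind4 Ind_z ^ 2) ^ r * q"
  shows "is_form (2 * r + 2) p \<and> \<not> sum_of_squares_of_trinomials p"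
proof
  let ?\<Lambda> = "const4 (l1 ^ 2) * ind4 Ind_w ^ 2 + const4 (l2 ^ 2) * ind4 Ind_x ^ 2
      + const4 (l3 ^ 2) * ind4 Ind_y ^ 2 + const4 (l4 ^ 2) * ind4 Ind_z ^ 2"
  have "is_form 2 ?\<Lambda>"
    by (intro is_form_add is_form_const4_mult_ind4_square)
  then show "is_form (2 * r + 2) p"
    unfolding p_def using is_form_mult[OF is_form_power assms(1)] by (metis mult.commute)
  show "\<not> sum_of_squares_of_trinomials p"
  proof
    assume "sum_of_squares_of_trinomials p"
    then obtain ts where ts: "\<forall>t\<in>set ts. trinomial t" "p = (\<Sum>t\<leftarrow>ts. t ^ 2)"
      unfolding sum_of_squares_of_trinomials_def by blast
    obtain A :: "real ^ indet ^ indet" where A: "\<And>i j. A $ i $ j = A $ j $ i" "\<And>i. 0 < A $ i $ i"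
      "\<forall>v k. v $ k = 0 \<longrightarrow> 0 \<le> A \<bullet> outer v" "A \<bullet> coeff_matrix q < 0"
      using separating_matrix[OF assms(1,2)] by blast
    obtain g where g: "\<And>i j. g (expo i + expo j) = A $ i $ j"
      "\<And>i m. g (expo i + expo i + m) = A $ i $ i * g m"
      "\<And>t. trinomial t \<Longrightarrow> 0 \<le> lin_ext g (t ^ 2)"
      using multiplicative_functional[OF A(1-3)] by blast
    \<comment> \<open>The value of the functional at the multiplier itself; it is positive because
      the diagonal of \<open>A\<close> is positive and some \<lambda> is nonzero.\<close>
    define K where "K = l1\<^sup>2 * A $ Ind_w $ Ind_w + l2\<^sup>2 * A $ Ind_x $ Ind_x
      + l3\<^sup>2 * A $ Ind_y $ Ind_y + l4\<^sup>2 * A $ Ind_z $ Ind_z"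
    have "lin_ext g (?\<Lambda> * f) = K * lin_ext g f" for f
      using lin_ext_single_mult[of g "expo i + expo i" "A $ i $ i" for i, OF g(2)]
      by (simp add: const4_mult_ind4_square distrib_right lin_ext_add K_def)
    then have "lin_ext g (?\<Lambda> ^ r * f) = K ^ r * lin_ext g f" for f
      by (induction r) (simp_all add: mult.assoc)
    then have "lin_ext g p = K ^ r * (A \<bullet> coeff_matrix q)"
      unfolding p_def using lin_ext_quad_form[OF g(1), of "coeff_matrix q"] quad_form_coeff_matrix[OF assms(1)]
      by simp
    moreover have "0 < K"
    proof -
      have nn: "0 \<le> l\<^sup>2 * A $ i $ i" for l i using A(2)[of i] by simp
      have pos: "0 < l\<^sup>2 * A $ i $ i" if "l \<noteq> 0" for l i using A(2)[of i] that by simp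
      note K = K_def nn[of l1 Ind_w] nn[of l2 Ind_x] nn[of l3 Ind_y] nn[of l4 Ind_z]
      from assms(3) consider "l1 \<noteq> 0" | "l2 \<noteq> 0" | "l3 \<noteq> 0" | "l4 \<noteq> 0" by blast
      then show ?thesis
      proof cases
        case 1
        then show ?thesis using K pos[of l1 Ind_w] by linarith
      next
        case 2
        then show ?thesis using K pos[of l2 Ind_x] by linarith
      next
        case 3
        then show ?thesis using K pos[of l3 Ind_y] by linarith
      next
        case 4
        then show ?thesis using K pos[of l4 Ind_z] by linarith
      qed
    qed
    ultimately have "lin_ext g p < 0"
      using A(4) by (simp add: mult_pos_neg)
    moreover have "0 \<le> lin_ext g p"
      unfolding ts(2) lin_ext_sum_list by (rule sum_list_nonneg) (use ts(1) g(3) in auto)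
    ultimately show False by simp
  qed
qed

end
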